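(* There is an absolute constant $C>0$ such that for every $n\ge2$ and every $Q'$-norm $l':\mathbb{R}^n\to\mathbb{R}$, $\mathrm{mmc}(l')\le C\log n$.
   Context: A norm $l:\mathbb{R}^n\to\mathbb{R}$ is symmetric if it is invariant under coordinate permutations and sign flips of coordinates. A norm $l:\mathbb{R}^n\to\mathbb{R}$ is a $Q$-norm if there is a symmetric norm $\Phi:\mathbb{R}^n\to\mathbb{R}$ such that $l(x)=\Phi(x^2)^{1/2}$ for all $x\in\mathbb{R}^n$, where $x^2=(x_1^2,\dots,x_n^2)$. A norm $l'$ on $\mathbb{R}^n$ is a $Q'$-norm if its dual norm $l(x)=\sup\{\langle x,y\rangle/l'(y):y\ne0\}$ is a $Q$-norm. For a symmetric norm $l$ on $\mathbb{R}^n$ and $k\le n$, $l^{(k)}$ is the norm on $\mathbb{R}^k$ given by $l^{(k)}(x_1,\dots,x_k)=l(x_1,\dots,x_k,0,\dots,0)$. For a norm $l$ on $\mathbb{R}^k$, $\mathfrak{b}_l=\max\{l(x):x\in S^{k-1}\}$, where $S^{k-1}$ is the $\ell_2$ unit sphere, and $\mathrm{M}_l$ is the (unique) median of $l(X)$ for $X$ uniform on $S^{k-1}$. $\mathrm{mc}(l)=\mathfrak{b}_l/\mathrm{M}_l$ and $\mathrm{mmc}(l)=\max_{1\le k\le n}\mathrm{mc}(l^{(k)})$. *)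

theory Defs
  imports "HOL-Probability.Probability" "HOL-Combinatorics.Permutations"
begin

text \<open>
  The dimension varies inside the statement, so a vector of \<open>\<real>\<^sup>n\<close> is a function
  \<open>nat \<Rightarrow> real\<close> vanishing outside \<open>{..<n}\<close> (coordinates are numbered from 0), as in the
  library's \<open>Euclidean_space n\<close>. A function on \<open>\<real>\<^sup>n\<close> is a function on \<open>nat \<Rightarrow> real\<close> of which only the values on \<open>Rn n\<close> matter.
\<close>

definition Rn :: "nat \<Rightarrow> (nat \<Rightarrow> real) set" where
  "Rn n = topspace (Euclidean_space n)"

lemma Rn_eq: "Rn n = {x. \<forall>i\<ge>n. x i = 0}"
  by (simp add: Rn_def topspace_Euclidean_space)

definition is_norm :: "nat \<Rightarrow> ((nat \<Rightarrow> real) \<Rightarrow> real) \<Rightarrow> bool" where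
  "is_norm n l \<longleftrightarrow>
     (\<forall>x\<in>Rn n. 0 \<le> l x) \<and>
     (\<forall>x\<in>Rn n. l x = 0 \<longleftrightarrow> x = (\<lambda>i. 0)) \<and>
     (\<forall>x\<in>Rn n. \<forall>a. l (\<lambda>i. a * x i) = \<bar>a\<bar> * l x) \<and>
     (\<forall>x\<in>Rn n. \<forall>y\<in>Rn n. l (\<lambda>i. x i + y i) \<le> l x + l y)"

definition symmetric_norm :: "nat \<Rightarrow> ((nat \<Rightarrow> real) \<Rightarrow> real) \<Rightarrow> bool" where
  "symmetric_norm n l \<longleftrightarrow> is_norm n l \<and>
     (\<forall>x\<in>Rn n. \<forall>p. p permutes {..<n} \<longrightarrow> l (\<lambda>i. x (p i)) = l x) \<and>
     (\<forall>x\<in>Rn n. \<forall>s. (\<forall>i. s i = 1 \<or> s i = - 1) \<longrightarrow> l (\<lambda>i. s i * x i) = l x)"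

definition Q_norm :: "nat \<Rightarrow> ((nat \<Rightarrow> real) \<Rightarrow> real) \<Rightarrow> bool" where
  "Q_norm n l \<longleftrightarrow> is_norm n l \<and>
     (\<exists>\<Phi>. symmetric_norm n \<Phi> \<and> (\<forall>x\<in>Rn n. l x = sqrt (\<Phi> (\<lambda>i. (x i)\<^sup>2))))"

definition dual_norm :: "nat \<Rightarrow> ((nat \<Rightarrow> real) \<Rightarrow> real) \<Rightarrow> (nat \<Rightarrow> real) \<Rightarrow> real" where
  "dual_norm n l x = (SUP y \<in> Rn n - {\<lambda>i. 0}. (\<Sum>i<n. x i * y i) / l y)"

definition Q'_norm :: "nat \<Rightarrow> ((nat \<Rightarrow> real) \<Rightarrow> real) \<Rightarrow> bool" where
  "Q'_norm n l \<longleftrightarrow> is_norm n l \<and> Q_norm n (dual_norm n l)"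

definition lower_norm :: "nat \<Rightarrow> ((nat \<Rightarrow> real) \<Rightarrow> real) \<Rightarrow> (nat \<Rightarrow> real) \<Rightarrow> real" where
  "lower_norm k l x = l (\<lambda>i. if i < k then x i else 0)"

text \<open>\<open>usphere k\<close> is the unit sphere of \<open>\<real>\<^sup>k\<close>, usually written \<open>S\<^bsup>k-1\<^esup>\<close>.\<close>

definition usphere :: "nat \<Rightarrow> (nat \<Rightarrow> real) set" where
  "usphere k = {x \<in> Rn k. L2_set x {..<k} = 1}"

text \<open>
  The uniform distribution on the sphere is the law of \<open>Y / \<bar>Y\<bar>\<close> for \<open>Y\<close> uniform in the
  unit ball (the normalised cone measure, which on the Euclidean sphere is the normalised
  surface measure). \<open>Y\<close> lives in the library's k-dimensional Lebesgue measure on functions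
  with index set \<open>{..<k}\<close>; the origin, a null set, is removed from the ball.
\<close>

definition punctured_ball :: "nat \<Rightarrow> (nat \<Rightarrow> real) set" where
  "punctured_ball k =
     {y \<in> space (\<Pi>\<^sub>M i\<in>{..<k}. lborel). 0 < L2_set y {..<k} \<and> L2_set y {..<k} \<le> 1}"

definition sphere_measure :: "nat \<Rightarrow> (nat \<Rightarrow> real) measure" where
  "sphere_measure k =
     distr (uniform_measure (restrict_space (\<Pi>\<^sub>M i\<in>{..<k}. lborel) (punctured_ball k))
                            (punctured_ball k))
           (restrict_space borel (usphere k))
           (\<lambda>y i. if i < k then y i / L2_set y {..<k} else 0)"

definition is_median :: "real measure \<Rightarrow> real \<Rightarrow> bool" where
  "is_median \<mu> m \<longleftrightarrow> measure \<mu> {..m} \<ge> 1 / 2 \<and> measure \<mu> {m..} \<ge> 1 / 2"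

text \<open>For a norm the median exists and is unique, see \<open>median_unique\<close> below.\<close>

definition sphere_median :: "nat \<Rightarrow> ((nat \<Rightarrow> real) \<Rightarrow> real) \<Rightarrow> real" where
  "sphere_median k l = (THE m. is_median (distr (sphere_measure k) borel l) m)"

text \<open>For a norm the supremum is attained, see \<open>sphere_max_attained\<close> below.\<close>

definition sphere_max :: "nat \<Rightarrow> ((nat \<Rightarrow> real) \<Rightarrow> real) \<Rightarrow> real" where
  "sphere_max k l = (SUP x \<in> usphere k. l x)"

definition mc :: "nat \<Rightarrow> ((nat \<Rightarrow> real) \<Rightarrow> real) \<Rightarrow> real" where
  "mc k l = sphere_max k l / sphere_median k l"

definition mmc :: "nat \<Rightarrow> ((nat \<Rightarrow> real) \<Rightarrow> real) \<Rightarrow> real" where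
  "mmc n l = Max ((\<lambda>k. mc k (lower_norm k l)) ` {1..n})"

section \<open>The sphere quantities of a norm are well defined\<close>

lemma pb_sets: "punctured_ball k \<in> sets (\<Pi>\<^sub>M i\<in>{..<k}. lborel)"
  unfolding punctured_ball_def L2_set_def by measurable

lemma pb_finite: "emeasure (\<Pi>\<^sub>M i\<in>{..<k}. lborel) (punctured_ball k) < \<infinity>"
proof -
  interpret product_sigma_finite "\<lambda>_::nat. lborel :: real measure" ..
  have "punctured_ball k \<subseteq> (\<Pi>\<^sub>E i\<in>{..<k}. {-1..1::real})"
  proof
    fix y assume y: "y \<in> punctured_ball k"
    have "\<bar>y i\<bar> \<le> 1" if "i < k" for i
      using member_le_L2_set[of "{..<k}" i "\<lambda>i. \<bar>y i\<bar>"] that y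
      unfolding punctured_ball_def L2_set_def by simp (metis order_trans real_sqrt_le_1_iff)
    then show "y \<in> (\<Pi>\<^sub>E i\<in>{..<k}. {-1..1::real})"
      using y by (simp add: punctured_ball_def space_PiM PiE_iff abs_le_iff minus_le_iff)
  qed
  then have "emeasure (\<Pi>\<^sub>M i\<in>{..<k}. lborel) (punctured_ball k)
      \<le> emeasure (\<Pi>\<^sub>M i\<in>{..<k}. lborel) (\<Pi>\<^sub>E i\<in>{..<k}. {-1..1::real})"
    by (intro emeasure_mono) auto
  also have "\<dots> = (\<Prod>i<k. emeasure lborel {-1..1::real})"
    by (subst emeasure_PiM) auto
  also have "\<dots> < \<infinity>" by (simp add: power_less_top_ennreal)
  finally show ?thesis .
qed

lemma box_pos:
  fixes k :: nat
  assumes "\<And>i. i < k \<Longrightarrow> a i < (b i :: real)" "A \<in> sets (\<Pi>\<^sub>M i\<in>{..<k}. lborel)"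
    "(\<Pi>\<^sub>E i\<in>{..<k}. {a i..b i}) \<subseteq> A"
  shows "0 < emeasure (\<Pi>\<^sub>M i\<in>{..<k}. lborel) A"
proof -
  interpret product_sigma_finite "\<lambda>_::nat. lborel :: real measure" ..
  have "0 < (\<Prod>i<k. emeasure lborel {a i..b i})"
    using assms(1) by (fastforce simp: zero_less_iff_neq_zero less_imp_le)
  also have "\<dots> = emeasure (\<Pi>\<^sub>M i\<in>{..<k}. lborel) (\<Pi>\<^sub>E i\<in>{..<k}. {a i..b i})"
    by (subst emeasure_PiM) auto
  also have "\<dots> \<le> emeasure (\<Pi>\<^sub>M i\<in>{..<k}. lborel) A"
    by (intro emeasure_mono assms)
  finally show ?thesis .
qed

lemma pb_pos: assumes "k \<ge> 1" shows "0 < emeasure (\<Pi>\<^sub>M i\<in>{..<k}. lborel) (punctured_ball k)"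
proof (rule box_pos[where a = "\<lambda>_. 1 / (2 * real k)" and b = "\<lambda>_. 1 / real k"])
  show "(\<Pi>\<^sub>E i\<in>{..<k}. {1 / (2 * real k)..1 / real k}) \<subseteq> punctured_ball k"
  proof
    fix y assume y: "y \<in> (\<Pi>\<^sub>E i\<in>{..<k}. {1 / (2 * real k)..1 / real k})"
    then have p: "0 < y i" "y i \<le> 1 / real k" if "i < k" for i
      using that assms by (auto simp: PiE_iff intro: less_le_trans[of 0 "1 / (2 * real k)"])
    have "L2_set y {..<k} \<le> (\<Sum>i<k. y i)" using p by (intro L2_set_le_sum) (auto simp: less_imp_le)
    also have "\<dots> \<le> (\<Sum>i<k. 1 / real k)" using p by (intro sum_mono) auto
    also have "\<dots> = 1" using assms by simp
    finally have 1: "L2_set y {..<k} \<le> 1" .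
    have "y 0 \<le> L2_set y {..<k}" using p assms by (intro member_le_L2_set) auto
    then have "0 < L2_set y {..<k}" using p(1)[of 0] assms by simp
    with 1 y show "y \<in> punctured_ball k" by (auto simp: punctured_ball_def space_PiM PiE_iff)
  qed
qed (use assms pb_sets in \<open>auto simp: field_simps\<close>)

lemma L2_normalized:
  assumes "0 < L2_set y {..<k}"
  shows "L2_set (\<lambda>i. if i < k then y i / L2_set y {..<k} else 0) {..<k} = 1"
proof -
  have "L2_set (\<lambda>i. if i < k then y i / L2_set y {..<k} else 0) {..<k}
     = L2_set (\<lambda>i. inverse (L2_set y {..<k}) * y i) {..<k}"
    by (intro L2_set_cong) (auto simp: field_simps)
  also have "\<dots> = inverse (L2_set y {..<k}) * L2_set y {..<k}"
    using assms by (intro L2_set_right_distrib[symmetric]) auto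
  finally show ?thesis using assms by simp
qed

lemma radial_measurable:
  "(\<lambda>y i. if i < k then y i / L2_set y {..<k} else 0) \<in>
     restrict_space (\<Pi>\<^sub>M i\<in>{..<k}. lborel) (punctured_ball k) \<rightarrow>\<^sub>M restrict_space borel (usphere k)"
proof (rule measurable_restrict_space2)
  show "(\<lambda>y i. if i < k then y i / L2_set y {..<k} else 0) \<in>
    space (restrict_space (\<Pi>\<^sub>M i\<in>{..<k}. lborel) (punctured_ball k)) \<rightarrow> usphere k"
    using L2_normalized by (auto simp: space_restrict_space usphere_def punctured_ball_def Rn_eq)
  have "(\<lambda>y i. if i < k then y i / L2_set y {..<k} else 0) \<in>
     (\<Pi>\<^sub>M i\<in>{..<k}. lborel) \<rightarrow>\<^sub>M (\<Pi>\<^sub>M i\<in>(UNIV::nat set). borel)"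
    unfolding L2_set_def
  proof (rule measurable_PiM_single')
    show "(\<lambda>y. if i < k then y i / sqrt (\<Sum>i<k. (y i)\<^sup>2) else 0)
        \<in> (\<Pi>\<^sub>M i\<in>{..<k}. lborel) \<rightarrow>\<^sub>M borel" for i
    proof (cases "i < k")
      case True
      then have 1: "(\<lambda>y. y i) \<in> (\<Pi>\<^sub>M i\<in>{..<k}. lborel) \<rightarrow>\<^sub>M (borel :: real measure)"
        using measurable_component_singleton[of i "{..<k}" "\<lambda>_. lborel :: real measure"] by simp
      have "(\<lambda>y. y i / sqrt (\<Sum>i<k. (y i)\<^sup>2)) \<in> (\<Pi>\<^sub>M i\<in>{..<k}. lborel) \<rightarrow>\<^sub>M (borel :: real measure)"
      proof (rule borel_measurable_divide[OF 1])
        show "(\<lambda>y. sqrt (\<Sum>i<k. (y i)\<^sup>2)) \<in> (\<Pi>\<^sub>M i\<in>{..<k}. lborel) \<rightarrow>\<^sub>M (borel :: real measure)"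
          by measurable
      qed
      with True show ?thesis by simp
    qed simp
  qed auto
  then show "(\<lambda>y i. if i < k then y i / L2_set y {..<k} else 0) \<in>
     restrict_space (\<Pi>\<^sub>M i\<in>{..<k}. lborel) (punctured_ball k) \<rightarrow>\<^sub>M borel"
    unfolding measurable_cong_sets[OF refl sets_PiM_equal_borel] by (rule measurable_restrict_space1)
qed

lemma prob_space_sphere_measure: assumes "k \<ge> 1" shows "prob_space (sphere_measure k)"
  unfolding sphere_measure_def
proof (intro prob_space.prob_space_distr prob_space_uniform_measure)
  have e: "emeasure (restrict_space (\<Pi>\<^sub>M i\<in>{..<k}. lborel) (punctured_ball k)) (punctured_ball k)
    = emeasure (\<Pi>\<^sub>M i\<in>{..<k}. lborel) (punctured_ball k)"
    using pb_sets by (intro emeasure_restrict_space) auto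
  show "emeasure (restrict_space (\<Pi>\<^sub>M i\<in>{..<k}. lborel) (punctured_ball k)) (punctured_ball k) \<noteq> 0"
    unfolding e using pb_pos[OF assms] by simp
  show "emeasure (restrict_space (\<Pi>\<^sub>M i\<in>{..<k}. lborel) (punctured_ball k)) (punctured_ball k) \<noteq> \<infinity>"
    unfolding e using pb_finite[of k] by simp
qed (use radial_measurable in \<open>simp add: measurable_def\<close>)

lemma norm_tri: "is_norm k l \<Longrightarrow> x \<in> Rn k \<Longrightarrow> y \<in> Rn k \<Longrightarrow> l (\<lambda>i. x i + y i) \<le> l x + l y"
  by (simp add: is_norm_def)

lemma norm_scale: "is_norm k l \<Longrightarrow> x \<in> Rn k \<Longrightarrow> l (\<lambda>i. a * x i) = \<bar>a\<bar> * l x"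
  by (simp add: is_norm_def)

lemma norm_le_sum:
  assumes "is_norm k l" "x \<in> Rn k"
  shows "l x \<le> (\<Sum>i<k. \<bar>x i\<bar> * l (\<lambda>j. of_bool (j = i)))"
proof -
  have e: "(\<lambda>j. of_bool (j = i)) \<in> Rn k" if "i < k" for i
    using that by (auto simp: Rn_eq)
  have "l (\<lambda>j. if j < m then x j else 0) \<le> (\<Sum>i<m. \<bar>x i\<bar> * l (\<lambda>j. of_bool (j = i)))"
    if "m \<le> k" for m using that
  proof (induction m)
    case 0
    then show ?case using assms(1) by (auto simp: is_norm_def Rn_eq)
  next
    case (Suc m)
    have eq: "(\<lambda>j. if j < Suc m then x j else 0)
       = (\<lambda>j. (if j < m then x j else 0) + x m * of_bool (j = m))"
      by (auto simp: less_Suc_eq)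
    have m: "(\<lambda>j. if j < m then x j else 0) \<in> Rn k" "(\<lambda>j. x m * of_bool (j = m)) \<in> Rn k"
      using Suc.prems by (auto simp: Rn_eq)
    have "l (\<lambda>j. if j < Suc m then x j else 0)
      \<le> l (\<lambda>j. if j < m then x j else 0) + l (\<lambda>j. x m * of_bool (j = m))"
      unfolding eq by (rule norm_tri[OF assms(1) m])
    also have "l (\<lambda>j. x m * of_bool (j = m)) = \<bar>x m\<bar> * l (\<lambda>j. of_bool (j = m))"
      using Suc.prems by (intro norm_scale[OF assms(1) e]) simp
    finally show ?case using Suc by simp
  qed
  from this[of k] have "l (\<lambda>j. if j < k then x j else 0) \<le> (\<Sum>i<k. \<bar>x i\<bar> * l (\<lambda>j. of_bool (j = i)))"
    by simp
  also have "(\<lambda>j. if j < k then x j else 0) = x" using assms(2) by (auto simp: Rn_eq)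
  finally show ?thesis .
qed

lemma norm_diff_le:
  assumes "is_norm k l" "x \<in> Rn k" "y \<in> Rn k"
  shows "\<bar>l x - l y\<bar> \<le> (\<Sum>i<k. \<bar>x i - y i\<bar> * l (\<lambda>j. of_bool (j = i)))"
proof -
  have tri: "l u \<le> l v + l (\<lambda>i. u i - v i)" if "u \<in> Rn k" "v \<in> Rn k" for u v
  proof -
    have "(\<lambda>i. u i - v i) \<in> Rn k" using that by (auto simp: Rn_eq)
    from norm_tri[OF assms(1) that(2) this] show ?thesis by simp
  qed
  have d: "(\<lambda>i. x i - y i) \<in> Rn k" "(\<lambda>i. y i - x i) \<in> Rn k" using assms by (auto simp: Rn_eq)
  show ?thesis
    using tri[OF assms(2,3)] tri[OF assms(3,2)] norm_le_sum[OF assms(1) d(1)] norm_le_sum[OF assms(1) d(2)]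
    by (simp add: abs_minus_commute abs_le_iff)
qed

lemma norm_continuous:
  assumes "is_norm k l"
  shows "continuous_on (Rn k) l"
  unfolding continuous_on_def
proof
  fix a assume a: "a \<in> Rn k"
  have "((\<lambda>x. \<Sum>i<k. \<bar>x i - a i\<bar> * l (\<lambda>j. of_bool (j = i))) \<longlongrightarrow>
     (\<Sum>i<k. \<bar>a i - a i\<bar> * l (\<lambda>j. of_bool (j = i)))) (at a within Rn k)"
  proof (intro tendsto_intros)
    fix i show "((\<lambda>x. x i) \<longlongrightarrow> a i) (at a within Rn k)"
      using continuous_on_product_coordinates[of i]
      by (metis UNIV_I continuous_on_def tendsto_within_subset top_greatest)
  qed
  then have "((\<lambda>x. l x - l a) \<longlongrightarrow> 0) (at a within Rn k)"
    by (intro Lim_null_comparison[where f = "\<lambda>x. l x - l a"])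
       (auto simp: eventually_at_filter norm_diff_le[OF assms _ a] intro!: always_eventually)
  then show "(l \<longlongrightarrow> l a) (at a within Rn k)" by (simp add: LIM_zero_cancel)
qed

lemma norm_measurable:
  assumes "is_norm k l"
  shows "l \<in> borel_measurable (restrict_space borel (usphere k))"
  by (rule borel_measurable_continuous_on_restrict)
     (use norm_continuous[OF assms] continuous_on_subset in \<open>fastforce simp: usphere_def\<close>)

lemma sphere_max_attained:
  assumes "is_norm k l" "k \<ge> 1"
  shows "\<exists>x\<in>usphere k. l x = sphere_max k l"
proof -
  let ?B = "\<Pi>\<^sub>E i\<in>UNIV. (if i < k then {-1..1::real} else {0})"
  have "compact ?B"
    using compactin_PiE[of "\<lambda>_. euclidean" UNIV "\<lambda>i. if i < k then {-1..1::real} else {0}"]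
    by (auto simp: euclidean_product_topology)
  moreover have "usphere k \<subseteq> ?B"
  proof
    fix x assume x: "x \<in> usphere k"
    have "\<bar>x i\<bar> \<le> 1" if "i < k" for i
      using member_le_L2_set[of "{..<k}" i "\<lambda>i. \<bar>x i\<bar>"] that x
      by (simp add: usphere_def L2_set_def)
    then show "x \<in> ?B" using x by (auto simp: usphere_def Rn_eq PiE_iff) fastforce+
  qed
  moreover have "closed (usphere k)"
  proof -
    have c: "continuous_on UNIV (\<lambda>x::nat\<Rightarrow>real. x i)" for i by simp
    have "usphere k = (\<Inter>i\<in>{k..}. {x. x i = 0}) \<inter> {x. sqrt (\<Sum>i<k. (x i)\<^sup>2) = 1}"
      by (auto simp: usphere_def Rn_eq L2_set_def)
    moreover have "closed \<dots>"
      by (intro closed_Int closed_INT ballI closed_Collect_eq continuous_intros c)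
    ultimately show ?thesis by simp
  qed
  ultimately have "compact (usphere k)"
    by (metis compact_Int_closed inf.absorb2)
  moreover have "(\<lambda>j. of_bool (j = 0)) \<in> usphere k"
    using assms(2) by (auto simp: usphere_def Rn_eq L2_set_def of_bool_def if_distrib[of "\<lambda>x. x ^ 2"] cong: if_cong)
  moreover have "continuous_on (usphere k) l"
    using norm_continuous[OF assms(1)] by (rule continuous_on_subset) (auto simp: usphere_def)
  ultimately obtain x where x: "x \<in> usphere k" "\<forall>y\<in>usphere k. l y \<le> l x"
    using continuous_attains_sup[of "usphere k" l] by blast
  then have "sphere_max k l = l x" unfolding sphere_max_def
    by (intro cSup_eq_maximum) auto
  with x show ?thesis by auto
qed

lemma median_exists:
  assumes "real_distribution M"
  shows "\<exists>m. is_median M m"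
proof -
  interpret real_distribution M by fact
  define S where "S = {t. cdf M t \<ge> 1/2}"
  have "eventually (\<lambda>t. cdf M t > 1/2) at_top"
    by (rule order_tendstoD[OF cdf_lim_at_top_prob]) simp
  then have ne: "S \<noteq> {}" unfolding S_def eventually_at_top_linorder by (fastforce intro: less_imp_le)
  have "eventually (\<lambda>t. cdf M t < 1/2) at_bot"
    by (rule order_tendstoD[OF cdf_lim_at_bot]) simp
  then obtain b where b: "\<And>t. t \<le> b \<Longrightarrow> cdf M t < 1/2" unfolding eventually_at_bot_linorder by auto
  have bdd: "bdd_below S"
  proof (rule bdd_belowI[of _ b])
    show "b \<le> x" if "x \<in> S" for x by (rule ccontr) (use b[of x] that in \<open>simp add: S_def\<close>)
  qed
  define m where "m = Inf S"
  have "cdf M t \<ge> 1/2" if t: "t > m" for t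
  proof -
    obtain s where "s \<in> S" "s < t" using cInf_lessD[OF ne, of t] t unfolding m_def by blast
    then show ?thesis using cdf_nondecreasing[of s t] by (auto simp: S_def)
  qed
  then have 1: "cdf M m \<ge> 1/2"
    using cdf_is_right_cont[of m] unfolding continuous_within
    by (intro tendsto_lowerbound[of "cdf M" _ "at_right m"])
       (auto simp: eventually_at_filter)
  have "cdf M t \<le> 1/2" if "t < m" for t
  proof (rule ccontr)
    assume "\<not> ?thesis"
    then have "t \<in> S" by (simp add: S_def)
    then show False using cInf_lower[OF _ bdd] that by (fastforce simp: m_def)
  qed
  then have 2: "measure M {..<m} \<le> 1/2"
    using cdf_at_left[of m]
    by (intro tendsto_upperbound[of "cdf M" _ "at_left m"])
       (auto simp: eventually_at_filter)
  have "measure M {m..} = 1 - measure M {..<m}"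
    using prob_compl[of "{..<m}"] by (simp add: Compl_eq_Diff_UNIV[symmetric] Compl_lessThan)
  with 1 2 show ?thesis by (auto simp: is_median_def cdf_def)
qed

definition trunc :: "nat \<Rightarrow> (nat \<Rightarrow> real) \<Rightarrow> nat \<Rightarrow> real" where
  "trunc k w = (\<lambda>i. if i < k then w i else 0)"

lemma trunc_Rn: "trunc k w \<in> Rn k" by (simp add: trunc_def Rn_eq)

lemma continuous_trunc: 
  assumes "is_norm k l" shows "continuous_on UNIV (\<lambda>w. l (trunc k w))"
proof -
  have "continuous_on UNIV (\<lambda>w. trunc k w i)" for i
    by (cases "i < k") (auto simp: trunc_def)
  then have "continuous_on UNIV (trunc k)"
    by (rule continuous_on_coordinatewise_then_product)
  then show ?thesis
    by (rule continuous_on_compose2[OF norm_continuous[OF assms]]) (auto simp: trunc_Rn)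
qed

lemma continuous_L2: "continuous_on UNIV (\<lambda>w::nat\<Rightarrow>real. L2_set w {..<k})"
  unfolding L2_set_def by (intro continuous_intros) simp

lemma radial_eq:
  assumes "is_norm k l"
  shows "l (\<lambda>i. if i < k then w i / L2_set w {..<k} else 0) = l (trunc k w) / L2_set w {..<k}"
proof -
  have e: "(\<lambda>i. if i < k then w i / L2_set w {..<k} else 0) = (\<lambda>i. inverse (L2_set w {..<k}) * trunc k w i)"
    by (auto simp: trunc_def field_simps)
  have "l (\<lambda>i. inverse (L2_set w {..<k}) * trunc k w i) = \<bar>inverse (L2_set w {..<k})\<bar> * l (trunc k w)"
    by (rule norm_scale[OF assms trunc_Rn])
  then show ?thesis unfolding e by (simp add: field_simps)
qed

lemma trunc_id: "x \<in> Rn k \<Longrightarrow> trunc k x = x"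
  by (auto simp: trunc_def Rn_eq)

lemma L2_trunc: "L2_set (trunc k w) {..<k} = L2_set w {..<k}"
  by (intro L2_set_cong) (auto simp: trunc_def)

lemma intermediate:
  assumes l: "is_norm k l" and xy: "x \<in> usphere k" "y \<in> usphere k" and c: "l x < c" "c < l y"
  shows "\<exists>z. 0 < L2_set z {..<k} \<and> l (trunc k z) / L2_set z {..<k} = c"
proof -
  define g where "g t = (\<lambda>i. (1 - t) * x i + t * y i)" for t
  have x: "x \<in> Rn k" "L2_set x {..<k} = 1" and y: "y \<in> Rn k" "L2_set y {..<k} = 1"
    using xy by (auto simp: usphere_def)
  have gR: "g t \<in> Rn k" for t using x y by (auto simp: g_def Rn_eq)
  have pos: "0 < L2_set (g t) {..<k}" if "0 \<le> t" "t \<le> 1" for t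
  proof (rule ccontr)
    assume "\<not> ?thesis"
    then have "L2_set (g t) {..<k} = 0" using L2_set_nonneg[of "g t" "{..<k}"] by linarith
    then have "\<forall>i<k. g t i = 0" by (simp add: L2_set_eq_0_iff)
    then have e: "(1 - t) * x i = - t * y i" for i
      using gR[of t] by (cases "i < k") (auto simp: g_def Rn_eq, (use x y in \<open>auto simp: Rn_eq\<close>)?)
    have e': "(\<lambda>i. (1 - t) * x i) = (\<lambda>i. - t * y i)" using e by blast
    have "(1 - t) * L2_set x {..<k} = L2_set (\<lambda>i. (1 - t) * x i) {..<k}"
      using that by (intro L2_set_right_distrib) auto
    also have "\<dots> = L2_set (\<lambda>i. t * y i) {..<k}"
      unfolding e' by (simp add: L2_set_def)
    also have "\<dots> = t * L2_set y {..<k}"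
      using that by (intro L2_set_right_distrib[symmetric]) auto
    finally have t: "t = 1/2" using x y by simp
    have "\<bar>1 - t\<bar> * l x = \<bar>- t\<bar> * l y"
      using norm_scale[OF l x(1), of "1 - t"] norm_scale[OF l y(1), of "- t"] unfolding e' by simp
    then show False using c t by simp
  qed
  have cg: "continuous_on {0..1} g"
    unfolding g_def by (intro continuous_on_coordinatewise_then_product continuous_intros)
  have "continuous_on {0..1} (\<lambda>t. l (trunc k (g t)) / L2_set (g t) {..<k})"
    using pos
    by (intro continuous_on_divide continuous_on_compose2[OF continuous_trunc[OF l] cg]
         continuous_on_compose2[OF continuous_L2 cg]) force+
  moreover have "g 0 = x" "g 1 = y" by (auto simp: g_def)
  ultimately obtain t where "0 \<le> t" "t \<le> 1" "l (trunc k (g t)) / L2_set (g t) {..<k} = c"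
    using IVT'[of "\<lambda>t. l (trunc k (g t)) / L2_set (g t) {..<k}" 0 c 1] c x y
    by (auto simp: trunc_id)
  with pos show ?thesis by blast
qed

lemma scaled_half:
  assumes l: "is_norm k l" and z: "0 < L2_set z {..<k}"
  defines "w \<equiv> \<lambda>i. (1 / (2 * L2_set z {..<k})) * trunc k z i"
  shows "L2_set w {..<k} = 1 / 2" "w \<in> Rn k"
    "l (trunc k w) / L2_set w {..<k} = l (trunc k z) / L2_set z {..<k}"
proof -
  show 1: "L2_set w {..<k} = 1 / 2" unfolding w_def
    using z by (subst L2_set_right_distrib[symmetric]) (auto simp: L2_trunc)
  show 2: "w \<in> Rn k" using trunc_Rn[of k z] by (auto simp: w_def Rn_eq)
  have "l w = \<bar>1 / (2 * L2_set z {..<k})\<bar> * l (trunc k z)"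
    unfolding w_def by (rule norm_scale[OF l trunc_Rn])
  then show "l (trunc k w) / L2_set w {..<k} = l (trunc k z) / L2_set z {..<k}"
    unfolding 1 trunc_id[OF 2] using z by simp
qed

lemma strip_pos:
  assumes l: "is_norm k l" and z: "0 < L2_set z {..<k}"
    "m1 < l (trunc k z) / L2_set z {..<k}" "l (trunc k z) / L2_set z {..<k} < m2"
    and A: "A \<in> sets (\<Pi>\<^sub>M i\<in>{..<k}. lborel)"
    "A = {w \<in> punctured_ball k. m1 < l (trunc k w) / L2_set w {..<k} \<and> l (trunc k w) / L2_set w {..<k} < m2}"
  shows "0 < emeasure (\<Pi>\<^sub>M i\<in>{..<k}. lborel) A"
proof -
  define w where "w = (\<lambda>i. (1 / (2 * L2_set z {..<k})) * trunc k z i)"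
  note w = scaled_half[OF l z(1), folded w_def]
  define U where "U = {w. 0 < L2_set w {..<k}} \<inter> {w. L2_set w {..<k} < 1} \<inter>
    {w. m1 * L2_set w {..<k} < l (trunc k w)} \<inter> {w. l (trunc k w) < m2 * L2_set w {..<k}}"
  have "open U" unfolding U_def
    by (intro open_Int open_Collect_less continuous_intros continuous_L2 continuous_trunc[OF l])
  moreover have "w \<in> U"
  proof -
    have "m1 < l (trunc k w) / L2_set w {..<k}" "l (trunc k w) / L2_set w {..<k} < m2"
      unfolding w(3) using z by auto
    then show ?thesis unfolding U_def w(1) by (simp add: w(1))
  qed
  ultimately obtain X where X: "w \<in> (\<Pi>\<^sub>E i\<in>UNIV. X i)" "\<And>i. open (X i)" "(\<Pi>\<^sub>E i\<in>UNIV. X i) \<subseteq> U"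
    using product_topology_open_contains_basis[of "\<lambda>_. euclidean" UNIV U w]
    by (auto simp: euclidean_product_topology)
  have "\<exists>a b. a < b \<and> {a..b} \<subseteq> X i" for i
  proof -
    obtain e where e: "e > 0" "cball (w i) e \<subseteq> X i"
      using X open_contains_cball by (metis PiE_mem UNIV_I)
    then show ?thesis
      by (intro exI[of _ "w i - e"] exI[of _ "w i + e"]) (auto simp: cball_eq_atLeastAtMost)
  qed
  then obtain a b where ab: "\<And>i. a i < b i" "\<And>i. {a i..b i} \<subseteq> X i" by metis
  show ?thesis
  proof (rule box_pos[where a = a and b = b])
    show "(\<Pi>\<^sub>E i\<in>{..<k}. {a i..b i}) \<subseteq> A"
    proof
      fix v assume v: "v \<in> (\<Pi>\<^sub>E i\<in>{..<k}. {a i..b i})"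
      have "trunc k v i \<in> X i" for i
      proof (cases "i < k")
        case True
        then have "v i \<in> {a i..b i}" using v by (auto simp: PiE_iff)
        with True ab(2)[of i] show ?thesis by (auto simp: trunc_def)
      next
        case False
        then have "w i = 0" using w(2) by (simp add: Rn_eq)
        then show ?thesis using X(1) False by (auto simp: trunc_def) (metis PiE_mem UNIV_I)
      qed
      then have "trunc k v \<in> U" using X(3) by auto
      then have "0 < L2_set v {..<k}" "L2_set v {..<k} < 1"
         "m1 * L2_set v {..<k} < l (trunc k v)" "l (trunc k v) < m2 * L2_set v {..<k}"
        unfolding U_def by (auto simp: L2_trunc trunc_id[OF trunc_Rn])
      moreover have "v \<in> space (\<Pi>\<^sub>M i\<in>{..<k}. lborel)" using v by (auto simp: space_PiM PiE_iff)
      ultimately show "v \<in> A"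
        unfolding A(2) punctured_ball_def by (simp add: field_simps)
    qed
  qed (use ab A in auto)
qed

lemma norm_measurable': "is_norm k l \<Longrightarrow> l \<in> sphere_measure k \<rightarrow>\<^sub>M borel"
  using norm_measurable[of k l] by (simp add: sphere_measure_def)

lemma real_distribution_law:
  assumes "is_norm k l" "k \<ge> 1"
  shows "real_distribution (distr (sphere_measure k) borel l)"
  using prob_space.real_distribution_distr[OF prob_space_sphere_measure norm_measurable'] assms by blast

lemma law_pos_D:
  assumes "is_norm k l" "0 < measure (distr (sphere_measure k) borel l) S" "S \<in> sets borel"
  shows "\<exists>x\<in>usphere k. l x \<in> S"
proof -
  have "measure (sphere_measure k) (l -` S \<inter> space (sphere_measure k)) > 0"
    using assms(2) by (simp add: measure_distr[OF norm_measurable'[OF assms(1)] assms(3)])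
  then have "l -` S \<inter> space (sphere_measure k) \<noteq> {}" by (metis less_irrefl measure_empty)
  then show ?thesis by (auto simp: sphere_measure_def space_restrict_space)
qed

lemma law_strip_pos:
  assumes l: "is_norm k l" and k: "k \<ge> 1"
    and z: "0 < L2_set z {..<k}" "m1 < l (trunc k z) / L2_set z {..<k}" "l (trunc k z) / L2_set z {..<k} < m2"
  shows "0 < measure (distr (sphere_measure k) borel l) {m1<..<m2}"
proof -
  let ?L = "\<Pi>\<^sub>M i\<in>{..<k}. lborel :: real measure"
  let ?R = "restrict_space ?L (punctured_ball k)"
  let ?r = "\<lambda>y i. if i < k then y i / L2_set y {..<k} else 0"
  define A where "A = {w \<in> punctured_ball k. m1 < l (trunc k w) / L2_set w {..<k} \<and> l (trunc k w) / L2_set w {..<k} < m2}"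
  interpret D: real_distribution "distr (sphere_measure k) borel l"
    by (rule real_distribution_law[OF l k])
  have sp: "space ?R = punctured_ball k" by (auto simp: space_restrict_space punctured_ball_def)
  have m: "(\<lambda>y. l (?r y)) \<in> ?R \<rightarrow>\<^sub>M borel"
    by (rule measurable_compose[OF radial_measurable norm_measurable[OF l]])
  have A': "A = (\<lambda>y. l (?r y)) -` {m1<..<m2} \<inter> space ?R"
    unfolding A_def sp radial_eq[OF l] by auto
  then have AR: "A \<in> sets ?R" using measurable_sets[OF m, of "{m1<..<m2}"] by simp
  then have AL: "A \<in> sets ?L" using pb_sets by (subst (asm) sets_restrict_space_iff) auto
  have pos: "0 < emeasure ?L A" by (rule strip_pos[OF l z AL A_def])
  have r: "?r \<in> uniform_measure ?R (punctured_ball k) \<rightarrow>\<^sub>M restrict_space borel (usphere k)"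
    using radial_measurable by (simp add: measurable_def)
  have "emeasure (distr (sphere_measure k) borel l) {m1<..<m2}
     = emeasure (sphere_measure k) (l -` {m1<..<m2} \<inter> space (sphere_measure k))"
    by (rule emeasure_distr[OF norm_measurable'[OF l]]) simp
  also have "\<dots> = emeasure (uniform_measure ?R (punctured_ball k))
      (?r -` (l -` {m1<..<m2} \<inter> space (sphere_measure k)) \<inter> space ?R)"
    using measurable_sets[OF norm_measurable'[OF l], of "{m1<..<m2}"]
    by (subst (1) sphere_measure_def, subst emeasure_distr[OF r]) (auto simp: sphere_measure_def)
  also have "?r -` (l -` {m1<..<m2} \<inter> space (sphere_measure k)) \<inter> space ?R = A"
    using measurable_space[OF radial_measurable, of _ k] unfolding A'
    by (auto simp: sphere_measure_def)
  also have "emeasure (uniform_measure ?R (punctured_ball k)) A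
      = emeasure ?R (punctured_ball k \<inter> A) / emeasure ?R (punctured_ball k)"
    using AR sets.top[of ?R] unfolding sp by (intro emeasure_uniform_measure) auto
  also have "punctured_ball k \<inter> A = A" by (auto simp: A_def)
  also have "emeasure ?R A = emeasure ?L A"
    using pb_sets by (intro emeasure_restrict_space) (auto simp: A_def)
  also have "emeasure ?R (punctured_ball k) = emeasure ?L (punctured_ball k)"
    using pb_sets by (intro emeasure_restrict_space) auto
  finally have "0 < emeasure (distr (sphere_measure k) borel l) {m1<..<m2}"
    using pos pb_finite[of k] by (simp add: ennreal_zero_less_divide)
  then show ?thesis by (simp add: D.emeasure_eq_measure)
qed

lemma median_unique:
  assumes l: "is_norm k l" and k: "k \<ge> 1"
  shows "\<exists>!m. is_median (distr (sphere_measure k) borel l) m"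
proof -
  let ?D = "distr (sphere_measure k) borel l"
  interpret D: real_distribution ?D by (rule real_distribution_law[OF l k])
  have False if m: "is_median ?D m1" "is_median ?D m2" and lt: "m1 < m2" for m1 m2
  proof -
    have h: "measure ?D {..m1} \<ge> 1/2" "measure ?D {m2..} \<ge> 1/2" using m by (auto simp: is_median_def)
    have "0 < measure ?D {..m1}" "0 < measure ?D {m2..}" using h by linarith+
    then obtain x y where xy: "x \<in> usphere k" "y \<in> usphere k" "l x \<le> m1" "m2 \<le> l y"
      using law_pos_D[OF l, of "{..m1}"] law_pos_D[OF l, of "{m2..}"] by auto
    define c where "c = (m1 + m2) / 2"
    have c: "m1 < c" "c < m2" using lt by (auto simp: c_def)
    obtain z where z: "0 < L2_set z {..<k}" "l (trunc k z) / L2_set z {..<k} = c"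
      using intermediate[OF l xy(1,2), of c] xy c by auto
    have "0 < measure ?D {m1<..<m2}" using law_strip_pos[OF l k z(1), of m1 m2] z c by simp
    moreover have "measure ?D ({..m1} \<union> {m1<..<m2}) = measure ?D {..m1} + measure ?D {m1<..<m2}"
      by (rule D.finite_measure_Union) auto
    moreover have "measure ?D (({..m1} \<union> {m1<..<m2}) \<union> {m2..}) = measure ?D ({..m1} \<union> {m1<..<m2}) + measure ?D {m2..}"
      using lt by (intro D.finite_measure_Union) auto
    ultimately show False using h D.prob_le_1[of "({..m1} \<union> {m1<..<m2}) \<union> {m2..}"] by linarith
  qed
  then show ?thesis using median_exists[OF D.real_distribution_axioms] by (metis linorder_less_linear)
qed

end

theory Submission
  imports Defs
begin

text \<open>
  Let \<open>l\<close> be the dual of \<open>l'\<close>, \<open>l x = \<Phi>(x\<^sup>2)\<^bsup>1/2\<^esup>\<close>, and let \<open>A\<close> be the value of \<open>l\<close> at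
  \<open>\<xi> = (1,\<dots>,1,0,\<dots>,0)\<close> with \<open>k\<close> ones. By Hahn-Banach, a unit vector \<open>x\<close> of \<open>\<real>\<^sup>k\<close> satisfies
  \<open>l' x \<le> \<langle>c, x\<rangle>\<close> for some \<open>c\<close> with \<open>\<Phi>(c\<^sup>2) \<le> 1\<close>. Averaging \<open>c\<^sup>2\<close> over sign flips and cyclic
  shifts of the first \<open>k\<close> coordinates gives \<open>(c\<^sub>1\<^sup>2 + \<dots> + c\<^sub>k\<^sup>2) A\<^sup>2 \<le> k\<close>, hence \<open>l' x \<le> \<surd>k / A\<close> by
  Cauchy-Schwarz. Conversely, pairing \<open>x\<close> with the sign vector of \<open>x\<close> gives \<open>l' x \<ge> \<bar>x\<bar>\<^sub>1 / A\<close>.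
  So it suffices that the median of the \<open>\<ell>\<^sub>1\<close> norm on the sphere is at least \<open>\<surd>k / 12\<close>, which
  follows by comparing the volume of the \<open>\<ell>\<^sub>1\<close> ball of radius \<open>\<surd>k / 12\<close> (exponential Markov bound)
  with that of a cube inscribed in the Euclidean ball. The resulting bound on \<open>mmc\<close> is the
  constant 12; the logarithm is not needed.
\<close>

section \<open>Supporting functionals\<close>

text \<open>Functionals live on all of \<open>nat \<Rightarrow> real\<close>, which avoids
  membership conditions; a norm enters through \<open>trunc\<close>. The scaling inequality already
  forces equality: scale back by \<open>1 / a\<close>, and at \<open>a = 0\<close> use
  subadditivity.\<close>

definition sublinear :: "((nat \<Rightarrow> real) \<Rightarrow> real) \<Rightarrow> bool" where
  "sublinear p \<longleftrightarrow> (\<forall>x y. p (\<lambda>i. x i + y i) \<le> p x + p y) \<and> (\<forall>a\<ge>0. \<forall>x. p (\<lambda>i. a * x i) \<le> a * p x)"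

lemma sublinear_add: "sublinear p \<Longrightarrow> p (\<lambda>i. x i + y i) \<le> p x + p y"
  by (simp add: sublinear_def)

lemma sublinear_scale: "sublinear p \<Longrightarrow> 0 \<le> a \<Longrightarrow> p (\<lambda>i. a * x i) \<le> a * p x"
  by (simp add: sublinear_def)

lemma sublinear_zero: assumes "sublinear p" shows "p (\<lambda>i. 0) = 0"
  using sublinear_add[OF assms, of "\<lambda>i. 0" "\<lambda>i. 0"] sublinear_scale[OF assms, of 0 "\<lambda>i. 0"] by simp

lemma sublinear_uminus: assumes "sublinear p" shows "- p x \<le> p (\<lambda>i. - x i)"
  using sublinear_add[OF assms, of x "\<lambda>i. - x i"] sublinear_zero[OF assms] by simp

text \<open>
  Hahn-Banach without Zorn: in finite dimension, a sublinear functional becomes linear after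
  being made linear in finitely many directions, one after another.
\<close>

lemma sublinear_flatten:
  assumes p: "sublinear p"
  shows "\<exists>q. sublinear q \<and> (\<forall>x. q x \<le> p x) \<and> q (\<lambda>i. - v i) \<le> - p v"
proof -
  \<comment> \<open>The infimum of \<open>g x t\<close> over \<open>t\<close> is the largest
    sublinear functional below \<open>p\<close> with value at most \<open>- p v\<close> at
    \<open>- v\<close>; \<open>t = 0\<close> and \<open>t = 1\<close> give these two bounds.\<close>
  define g where "g x t = p (\<lambda>i. x i + t * v i) - t * p v" for x and t :: real
  define q where "q x = (INF t\<in>{0..}. g x t)" for x
  \<comment> \<open>A bound independent of \<open>t\<close> keeps the infimum finite. Scaling is an
    upper bound, so \<open>t * p v\<close> is compared with the value at \<open>t * v\<close> by
    scaling back with \<open>1 / t\<close>.\<close>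
  have lb: "- p (\<lambda>i. - x i) \<le> g x t" if "0 \<le> t" for x t
  proof -
    have "t * p v = t * p (\<lambda>i. (1/t) * (t * v i))" by (cases "t = 0") auto
    also have "\<dots> \<le> p (\<lambda>i. t * v i)"
      using that sublinear_scale[OF p, of "1/t" "\<lambda>i. t * v i"] sublinear_zero[OF p]
      by (cases "t = 0") (auto simp: field_simps)
    also have "\<dots> \<le> p (\<lambda>i. x i + t * v i) + p (\<lambda>i. - x i)"
      using sublinear_add[OF p, of "\<lambda>i. x i + t * v i" "\<lambda>i. - x i"] by simp
    finally show ?thesis by (simp add: g_def)
  qed
  have q_le: "q x \<le> g x t" if "0 \<le> t" for x t
    unfolding q_def using lb that by (intro cINF_lower bdd_belowI2[of _ "- p (\<lambda>i. - x i)"]) auto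
  have q_ge: "c \<le> q x" if "\<And>t. 0 \<le> t \<Longrightarrow> c \<le> g x t" for c x
    unfolding q_def using that by (intro cINF_greatest) auto
  have add: "q (\<lambda>i. x i + y i) \<le> q x + q y" for x y
  proof -
    have "q (\<lambda>i. x i + y i) \<le> g x s + g y t" if "0 \<le> s" "0 \<le> t" for s t
    proof -
      have "p (\<lambda>i. (x i + y i) + (s + t) * v i) \<le> p (\<lambda>i. x i + s * v i) + p (\<lambda>i. y i + t * v i)"
        using sublinear_add[OF p, of "\<lambda>i. x i + s * v i" "\<lambda>i. y i + t * v i"]
        by (simp add: algebra_simps)
      with q_le[of "s + t" "\<lambda>i. x i + y i"] that show ?thesis
        by (simp add: g_def algebra_simps)
    qed
    \<comment> \<open>The infimum is taken in \<open>t\<close> with \<open>s\<close> fixed, and then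
      in \<open>s\<close>.\<close>
    then have "q (\<lambda>i. x i + y i) - g x s \<le> q y" if "0 \<le> s" for s
      using that by (intro q_ge) (simp add: algebra_simps)
    then have "q (\<lambda>i. x i + y i) - q y \<le> q x"
      by (intro q_ge) (simp add: algebra_simps)
    then show ?thesis by simp
  qed
  have scale: "q (\<lambda>i. a * x i) \<le> a * q x" if "0 \<le> a" for a x
  proof -
    have le: "q (\<lambda>i. a * x i) \<le> a * g x t" if "0 \<le> t" for t
    proof -
      have "p (\<lambda>i. a * x i + (a * t) * v i) \<le> a * p (\<lambda>i. x i + t * v i)"
        using sublinear_scale[OF p \<open>0 \<le> a\<close>, of "\<lambda>i. x i + t * v i"] by (simp add: algebra_simps)
      with q_le[of "a * t" "\<lambda>i. a * x i"] that \<open>0 \<le> a\<close> show ?thesis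
        by (simp add: g_def algebra_simps)
    qed
    show ?thesis
    proof (cases "a = 0")
      case True
      with le[of 0] show ?thesis by simp
    next
      case False
      with that have a: "0 < a" by simp
      then have "q (\<lambda>i. a * x i) / a \<le> q x"
        using le by (intro q_ge) (simp add: pos_divide_le_eq mult.commute)
      with a show ?thesis by (simp add: pos_divide_le_eq mult.commute)
    qed
  qed
  have "q x \<le> p x" for x using q_le[of 0 x] by (simp add: g_def)
  moreover have "q (\<lambda>i. - v i) \<le> - p v"
    using q_le[of 1 "\<lambda>i. - v i"] sublinear_zero[OF p] by (simp add: g_def)
  ultimately show ?thesis using add scale unfolding sublinear_def by blast
qed

text \<open>Flattened directions stay flat below a smaller functional: if \<open>r\<close> is below
  \<open>q\<close>, then r(-u) <= q(-u) <= -q(u) <= -r(u). So each induction step treats only the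
  new direction.\<close>

lemma sublinear_flatten_finite:
  assumes "finite F" "sublinear p"
  shows "\<exists>q. sublinear q \<and> (\<forall>x. q x \<le> p x) \<and> (\<forall>v\<in>F. q (\<lambda>i. - v i) \<le> - q v)"
  using assms(1)
proof (induction F)
  case empty
  then show ?case using assms(2) by auto
next
  case (insert v F)
  then obtain q where q: "sublinear q" "\<And>x. q x \<le> p x" "\<And>u. u \<in> F \<Longrightarrow> q (\<lambda>i. - u i) \<le> - q u"
    by blast
  obtain r where r: "sublinear r" "\<And>x. r x \<le> q x" "r (\<lambda>i. - v i) \<le> - q v"
    using sublinear_flatten[OF q(1)] by blast
  have "r (\<lambda>i. - u i) \<le> - r u" if "u \<in> insert v F" for u
    using that r(2)[of u] r(2)[of "\<lambda>i. - u i"] r(3) q(3)[of u] by fastforce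
  moreover have "r x \<le> p x" for x using r(2) q(2) order_trans by blast
  ultimately show ?case using r(1) by blast
qed

text \<open>Flattening along \<open>x0\<close> first keeps the value there from dropping below
  \<open>p x0\<close>; flattening along the unit vectors then makes the functional linear on
  \<open>Rn n\<close>, its values at them being the coefficients.\<close>

lemma sublinear_support:
  assumes p: "sublinear p" and x0: "x0 \<in> Rn n"
  shows "\<exists>c. (\<forall>x\<in>Rn n. (\<Sum>i<n. c i * x i) \<le> p x) \<and> p x0 \<le> (\<Sum>i<n. c i * x0 i)"
proof -
  define e :: "nat \<Rightarrow> nat \<Rightarrow> real" where "e i = (\<lambda>j. of_bool (j = i))" for i
  obtain q0 where q0: "sublinear q0" "\<And>x. q0 x \<le> p x" "q0 (\<lambda>i. - x0 i) \<le> - p x0"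
    using sublinear_flatten[OF p] by blast
  obtain q where q: "sublinear q" "\<And>x. q x \<le> q0 x" "\<And>v. v \<in> e ` {..<n} \<Longrightarrow> q (\<lambda>i. - v i) \<le> - q v"
    using sublinear_flatten_finite[OF _ q0(1), of "e ` {..<n}"] by blast
  have single: "q (\<lambda>j. a * e i j) \<le> q (e i) * a" if "i < n" for a i
  proof (cases "0 \<le> a")
    case True
    show ?thesis by (rule order_trans[OF sublinear_scale[OF q(1) True] eq_refl[OF mult.commute]])
  next
    case False
    then have "q (\<lambda>j. (- a) * (- e i j)) \<le> (- a) * q (\<lambda>j. - e i j)"
      by (intro sublinear_scale[OF q(1)]) simp
    also have "\<dots> \<le> (- a) * (- q (e i))"
      using False q(3)[of "e i"] that by (intro mult_left_mono) auto
    also have "\<dots> = q (e i) * a" by (simp add: mult.commute)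
    finally show ?thesis by simp
  qed
  have bound: "q (\<lambda>j. if j < m then x j else 0) \<le> (\<Sum>i<m. q (e i) * x i)" if "m \<le> n" for m x
    using that
  proof (induction m)
    case 0
    then show ?case by (simp add: sublinear_zero[OF q(1)])
  next
    case (Suc m)
    have "(\<lambda>j. if j < Suc m then x j else 0) = (\<lambda>j. (if j < m then x j else 0) + x m * e m j)"
      by (auto simp: less_Suc_eq e_def)
    with sublinear_add[OF q(1), of "\<lambda>j. if j < m then x j else 0" "\<lambda>j. x m * e m j"]
      single[of m "x m"] Suc show ?case by simp
  qed
  have le: "q x \<le> (\<Sum>i<n. q (e i) * x i)" if "x \<in> Rn n" for x
  proof -
    have "(\<lambda>j. if j < n then x j else 0) = x" using that by (auto simp: Rn_eq fun_eq_iff)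
    then have "q (\<lambda>j. if j < n then x j else 0) = q x" by (rule arg_cong)
    from bound[OF order_refl, of x, unfolded this] show ?thesis .
  qed
  have neg: "(\<lambda>i. - x i) \<in> Rn n" if "x \<in> Rn n" for x using that by (auto simp: Rn_eq)
  \<comment> \<open>The upper bound at \<open>x\<close> and at \<open>- x\<close> squeezes
    \<open>q x\<close>, since q(-x) >= -q(x).\<close>
  have eq: "q x = (\<Sum>i<n. q (e i) * x i)" if "x \<in> Rn n" for x
    using le[OF that] le[OF neg[OF that]] sublinear_uminus[OF q(1), of x]
    by (simp add: sum_negf)
  have "p x0 \<le> (\<Sum>i<n. q (e i) * x0 i)"
    using eq[OF neg[OF x0]] q(2)[of "\<lambda>i. - x0 i"] q0(3) by (simp add: sum_negf)
  moreover have "(\<Sum>i<n. q (e i) * x i) \<le> p x" if "x \<in> Rn n" for x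
    using eq[OF that] q(2)[of x] q0(2)[of x] by linarith
  ultimately show ?thesis by (intro exI[of _ "\<lambda>i. q (e i)"]) simp
qed

lemma norm_supporting_functional:
  assumes l: "is_norm n l" and x0: "x0 \<in> Rn n"
  shows "\<exists>c\<in>Rn n. (\<forall>x\<in>Rn n. (\<Sum>i<n. c i * x i) \<le> l x) \<and> l x0 \<le> (\<Sum>i<n. c i * x0 i)"
proof -
  have "sublinear (\<lambda>x. l (trunc n x))"
  proof -
    have "l (trunc n (\<lambda>i. x i + y i)) \<le> l (trunc n x) + l (trunc n y)" for x y
    proof -
      have "trunc n (\<lambda>i. x i + y i) = (\<lambda>i. trunc n x i + trunc n y i)" by (auto simp: trunc_def)
      then show ?thesis using norm_tri[OF l trunc_Rn trunc_Rn] by simp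
    qed
    moreover have "l (trunc n (\<lambda>i. a * x i)) \<le> a * l (trunc n x)" if "0 \<le> a" for a x
    proof -
      have "trunc n (\<lambda>i. a * x i) = (\<lambda>i. a * trunc n x i)" by (auto simp: trunc_def)
      then show ?thesis using norm_scale[OF l trunc_Rn, of a] that by simp
    qed
    ultimately show ?thesis by (simp add: sublinear_def)
  qed
  from sublinear_support[OF this x0] obtain c where
    c: "\<And>x. x \<in> Rn n \<Longrightarrow> (\<Sum>i<n. c i * x i) \<le> l x" "l x0 \<le> (\<Sum>i<n. c i * x0 i)"
    using x0 by (auto simp: trunc_id)
  have "(\<Sum>i<n. trunc n c i * x i) = (\<Sum>i<n. c i * x i)" for x
    by (intro sum.cong) (auto simp: trunc_def)
  with c trunc_Rn[of n c] show ?thesis by (intro bexI[of _ "trunc n c"]) auto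
qed

section \<open>Duality and averaging\<close>

text \<open>Vectors are functions on all of \<open>nat\<close>, so Tychonoff is applied to an
  infinite box whose sides are {0} from \<open>k\<close> on.\<close>

lemma compact_usphere: "compact (usphere k)"
proof -
  let ?B = "\<Pi>\<^sub>E i\<in>UNIV. (if i < k then {-1..1::real} else {0})"
  have "compact ?B"
    using compactin_PiE[of "\<lambda>_. euclidean" UNIV "\<lambda>i. if i < k then {-1..1::real} else {0}"]
    by (auto simp: euclidean_product_topology)
  moreover have "usphere k \<subseteq> ?B"
  proof
    fix x assume x: "x \<in> usphere k"
    have "\<bar>x i\<bar> \<le> 1" if "i < k" for i
      using member_le_L2_set[of "{..<k}" i "\<lambda>i. \<bar>x i\<bar>"] that x
      by (simp add: usphere_def L2_set_def)
    then show "x \<in> ?B" using x by (auto simp: usphere_def Rn_eq PiE_iff) fastforce+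
  qed
  moreover have "closed (usphere k)"
  proof -
    have c: "continuous_on UNIV (\<lambda>x::nat\<Rightarrow>real. x i)" for i by simp
    have "usphere k = (\<Inter>i\<in>{k..}. {x. x i = 0}) \<inter> {x. sqrt (\<Sum>i<k. (x i)\<^sup>2) = 1}"
      by (auto simp: usphere_def Rn_eq L2_set_def)
    moreover have "closed \<dots>"
      by (intro closed_Int closed_INT ballI closed_Collect_eq continuous_intros c)
    ultimately show ?thesis by simp
  qed
  ultimately show ?thesis by (metis compact_Int_closed inf.absorb2)
qed

lemma L2_pos: assumes "x \<in> Rn n" "x \<noteq> (\<lambda>i. 0)" shows "0 < L2_set x {..<n}"
proof -
  obtain i where "x i \<noteq> 0" using assms(2) by auto
  moreover from this have "i < n" using assms(1) by (auto simp: Rn_eq not_less[symmetric])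
  ultimately have "L2_set x {..<n} \<noteq> 0" by (auto simp: L2_set_eq_0_iff)
  then show ?thesis using L2_set_nonneg[of x "{..<n}"] by linarith
qed

text \<open>For \<open>d\<close> take the minimum of \<open>l\<close> on the compact sphere, which
  is attained and hence positive. An empty sphere means that \<open>Rn n\<close> is {0}, where any
  \<open>d\<close> works.\<close>

lemma norm_ge_L2:
  assumes l: "is_norm n l"
  shows "\<exists>d>0. \<forall>y\<in>Rn n. d * L2_set y {..<n} \<le> l y"
proof (cases "usphere n = {}")
  case True
  have zero: "y = (\<lambda>i. 0)" if "y \<in> Rn n" for y
  proof (rule ccontr)
    assume "y \<noteq> (\<lambda>i. 0)"
    from L2_pos[OF that this]
    have "(\<lambda>i. if i < n then y i / L2_set y {..<n} else 0) \<in> usphere n"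
      using L2_normalized[of y n] by (simp add: usphere_def Rn_eq)
    with True show False by simp
  qed
  have "L2_set y {..<n} = 0" if "y \<in> Rn n" for y
    by (subst zero[OF that]) (simp add: L2_set_def)
  moreover have "0 \<le> l y" if "y \<in> Rn n" for y using that l by (simp add: is_norm_def)
  ultimately have "L2_set y {..<n} \<le> l y" if "y \<in> Rn n" for y using that by simp
  then show ?thesis by (intro exI[of _ 1]) auto
next
  case False
  have sub: "usphere n \<subseteq> Rn n" by (auto simp: usphere_def)
  obtain x where x: "x \<in> usphere n" "\<And>y. y \<in> usphere n \<Longrightarrow> l x \<le> l y"
    using continuous_attains_inf[OF compact_usphere False
        continuous_on_subset[OF norm_continuous[OF l] sub]] by blast
  have "x \<noteq> (\<lambda>i. 0)" using x(1) by (auto simp: usphere_def L2_set_def)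
  then have "0 < l x" using l x(1) sub unfolding is_norm_def by (metis order_le_less subsetD)
  moreover have "l x * L2_set y {..<n} \<le> l y" if y: "y \<in> Rn n" for y
  proof (cases "y = (\<lambda>i. 0)")
    case True
    then show ?thesis using l y by (auto simp: is_norm_def L2_set_def)
  next
    case False
    note pos = L2_pos[OF y False]
    have "(\<lambda>i. if i < n then y i / L2_set y {..<n} else 0) \<in> usphere n"
      using L2_normalized[OF pos] by (auto simp: usphere_def Rn_eq)
    from x(2)[OF this] pos show ?thesis
      unfolding radial_eq[OF l] trunc_id[OF y] by (simp add: pos_le_divide_eq)
  qed
  ultimately show ?thesis by blast
qed

text \<open>The point is that the supremum defining \<open>dual_norm\<close> is bounded:
  Cauchy-Schwarz together with \<open>norm_ge_L2\<close> bounds every quotient.\<close>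

lemma pairing_le_dual:
  assumes l: "is_norm n l" and x: "x \<in> Rn n" and y: "y \<in> Rn n"
  shows "(\<Sum>i<n. x i * y i) \<le> dual_norm n l x * l y"
proof (cases "y = (\<lambda>i. 0)")
  case True
  then show ?thesis using l y by (auto simp: is_norm_def)
next
  case False
  obtain d where d: "0 < d" "\<And>y. y \<in> Rn n \<Longrightarrow> d * L2_set y {..<n} \<le> l y"
    using norm_ge_L2[OF l] by blast
  have pos: "0 < l z" if "z \<in> Rn n" "z \<noteq> (\<lambda>i. 0)" for z
    using that l unfolding is_norm_def by (metis order_le_less)
  have "(\<Sum>i<n. x i * z i) / l z \<le> L2_set x {..<n} / d" if z: "z \<in> Rn n" "z \<noteq> (\<lambda>i. 0)" for z
  proof -
    have "(\<Sum>i<n. x i * z i) \<le> (\<Sum>i<n. \<bar>x i\<bar> * \<bar>z i\<bar>)"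
      by (intro sum_mono) (metis abs_ge_self abs_mult)
    also have "\<dots> \<le> L2_set x {..<n} * L2_set z {..<n}" by (rule L2_set_mult_ineq)
    also have "\<dots> \<le> L2_set x {..<n} * (l z / d)"
      using d(1) d(2)[OF z(1)] by (intro mult_left_mono) (auto simp: field_simps)
    finally show ?thesis using pos[OF z] by (simp add: field_simps)
  qed
  then have "bdd_above ((\<lambda>z. (\<Sum>i<n. x i * z i) / l z) ` (Rn n - {\<lambda>i. 0}))"
    by (intro bdd_aboveI2[of _ _ "L2_set x {..<n} / d"]) auto
  then have "(\<Sum>i<n. x i * y i) / l y \<le> dual_norm n l x"
    unfolding dual_norm_def by (intro cSUP_upper) (use y False in auto)
  then show ?thesis using pos[OF y False] by (simp add: pos_divide_le_eq)
qed

text \<open>One half of biduality: a supporting functional at \<open>x\<close> is dominated by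
  \<open>l\<close>, so its dual norm is at most 1.\<close>

lemma norm_attained_by_dual:
  assumes l: "is_norm n l" and n: "n \<ge> 1" and x: "x \<in> Rn n"
  shows "\<exists>c\<in>Rn n. dual_norm n l c \<le> 1 \<and> l x \<le> (\<Sum>i<n. c i * x i)"
proof -
  obtain c where c: "c \<in> Rn n" "\<And>x. x \<in> Rn n \<Longrightarrow> (\<Sum>i<n. c i * x i) \<le> l x"
    "l x \<le> (\<Sum>i<n. c i * x i)"
    using norm_supporting_functional[OF l x] by blast
  \<comment> \<open>The supremum must range over a nonempty set, which \<open>n \<ge> 1\<close>
    provides.\<close>
  have "(\<lambda>j. of_bool (j = 0)) \<in> Rn n - {\<lambda>i. 0}"
    using n by (auto simp: Rn_eq fun_eq_iff)
  then have "dual_norm n l c \<le> 1"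
    unfolding dual_norm_def
  proof (intro cSUP_least)
    fix z assume z: "z \<in> Rn n - {\<lambda>i. 0}"
    then have "0 < l z" using l unfolding is_norm_def
      by (metis DiffD1 DiffD2 insertI1 order_le_less)
    then show "(\<Sum>i<n. c i * z i) / l z \<le> 1" using c(2)[of z] z by (simp add: pos_divide_le_eq)
  qed auto
  with c show ?thesis by (intro bexI[of _ c]) simp_all
qed

section \<open>Averaging over coordinate symmetries\<close>

lemma norm_sum_le:
  assumes l: "is_norm n l" and f: "\<And>m. m < k \<Longrightarrow> f m \<in> Rn n"
  shows "l (\<lambda>i. \<Sum>m<(k::nat). f m i) \<le> (\<Sum>m<k. l (f m))"
  using f
proof (induction k)
  case 0
  then show ?case using l by (auto simp: is_norm_def Rn_eq)
next
  case (Suc k)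
  have "(\<lambda>i. \<Sum>m<k. f m i) \<in> Rn n" using Suc.prems by (auto simp: Rn_eq)
  from norm_tri[OF l this Suc.prems[of k]] Suc show ?case by fastforce
qed

text \<open>At a fixed position \<open>i\<close>, the shifts bring every entry to \<open>i\<close>
  exactly once. Hence the sum of all shifts of a vector is constant on the first \<open>k\<close>
  coordinates.\<close>

lemma sum_cyclic_shift:
  fixes v :: "nat \<Rightarrow> 'a::comm_monoid_add"
  assumes "i < k"
  shows "(\<Sum>m<k. v ((i + m) mod k)) = (\<Sum>m<k. v m)"
proof (rule sum.reindex_bij_witness[where i = "\<lambda>m. (m + (k - i)) mod k" and j = "\<lambda>m. (i + m) mod k"])
  show "((i + m) mod k + (k - i)) mod k = m" if "m \<in> {..<k}" for m
  proof -
    have "((i + m) mod k + (k - i)) mod k = (i + m + (k - i)) mod k" by (simp add: mod_add_left_eq)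
    also have "i + m + (k - i) = m + k" using assms by simp
    finally show ?thesis using that by simp
  qed
  show "(i + (m + (k - i)) mod k) mod k = m" if "m \<in> {..<k}" for m
  proof -
    have "(i + (m + (k - i)) mod k) mod k = (i + (m + (k - i))) mod k" by (simp add: mod_add_right_eq)
    also have "i + (m + (k - i)) = m + k" using assms by simp
    finally show ?thesis using that by simp
  qed
qed (use assms in auto)

lemma cyclic_shift_permutes:
  fixes k n m :: nat
  assumes "k \<le> n"
  shows "(\<lambda>i. if i < k then (i + m) mod k else i) permutes {..<n}"
proof (cases "k = 0")
  case True
  then show ?thesis by (simp add: permutes_id[unfolded id_def])
next
  case False
  let ?\<sigma> = "\<lambda>i. if i < k then (i + m) mod k else i"
  have "inj_on ?\<sigma> {..<k}"
  proof (rule inj_onI)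
    fix i j assume ij: "i \<in> {..<k}" "j \<in> {..<k}" and "?\<sigma> i = ?\<sigma> j"
    then have e: "(i + m) mod k = (j + m) mod k" by simp
    \<comment> \<open>Adding \<open>k * m - m\<close> undoes the shift by \<open>m\<close> modulo
      \<open>k\<close> without a negative number.\<close>
    have "((i + m) mod k + (k * m - m)) mod k = ((j + m) mod k + (k * m - m)) mod k"
      by (simp only: e)
    then have eq: "(i + m + (k * m - m)) mod k = (j + m + (k * m - m)) mod k"
      by (simp only: mod_add_left_eq)
    have "m \<le> k * m" using False by simp
    then have shift: "a + m + (k * m - m) = a + m * k" for a by (simp add: mult.commute)
    have "i mod k = j mod k" using eq by (simp only: shift mod_mult_self1)
    with ij show "i = j" by simp
  qed
  moreover have "?\<sigma> ` {..<k} \<subseteq> {..<k}" using False by auto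
  ultimately have "bij_betw ?\<sigma> {..<k} {..<k}"
    unfolding bij_betw_def using endo_inj_surj[of "{..<k}" ?\<sigma>] by blast
  then have "?\<sigma> permutes {..<k}"
    by (rule bij_imp_permutes) auto
  then show ?thesis by (rule permutes_subset) (use assms in auto)
qed

text \<open>The \<open>k\<close> cyclic shifts of the truncated vector add up to the sum of its
  entries times the indicator of the first \<open>k\<close> coordinates; each shift has norm at most
  \<open>\<Phi> u\<close>.\<close>

lemma symmetric_norm_average:
  assumes \<Phi>: "symmetric_norm n \<Phi>" and u: "u \<in> Rn n" and k: "k \<le> n"
  shows "\<bar>\<Sum>i<k. u i\<bar> * \<Phi> (\<lambda>i. of_bool (i < k)) \<le> real k * \<Phi> u"
proof -
  have N: "is_norm n \<Phi>" using \<Phi> by (simp add: symmetric_norm_def)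
  have v: "trunc k u \<in> Rn n" using k by (auto simp: trunc_def Rn_eq)
  have trunc: "\<Phi> (trunc k u) \<le> \<Phi> u"
  proof -
    \<comment> \<open>Adding to \<open>u\<close> its copy with signs flipped from \<open>k\<close>
      on erases those coordinates, so truncation does not increase \<open>\<Phi>\<close>.\<close>
    define s :: "nat \<Rightarrow> real" where "s i = (if i < k then 1 else - 1)" for i
    have su: "(\<lambda>i. s i * u i) \<in> Rn n" using u by (auto simp: Rn_eq)
    have "2 * \<Phi> (trunc k u) = \<Phi> (\<lambda>i. 2 * trunc k u i)" using norm_scale[OF N v, of 2] by simp
    also have "(\<lambda>i. 2 * trunc k u i) = (\<lambda>i. u i + s i * u i)" by (auto simp: s_def trunc_def)
    also have "\<Phi> \<dots> \<le> \<Phi> u + \<Phi> (\<lambda>i. s i * u i)" by (rule norm_tri[OF N u su])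
    also have "\<Phi> (\<lambda>i. s i * u i) = \<Phi> u"
      using \<Phi> u by (simp add: symmetric_norm_def s_def)
    finally show ?thesis by simp
  qed
  define \<sigma> where "\<sigma> m = (\<lambda>i. if i < k then (i + m) mod k else i)" for m
  have shift: "\<Phi> (\<lambda>i. trunc k u (\<sigma> m i)) = \<Phi> (trunc k u)" for m
    using \<Phi> v cyclic_shift_permutes[OF k, of m, folded \<sigma>_def] by (simp add: symmetric_norm_def)
  have \<xi>: "(\<lambda>i. of_bool (i < k)) \<in> Rn n" using k by (auto simp: Rn_eq)
  have "(\<lambda>i. (\<Sum>i<k. u i) * of_bool (i < k)) = (\<lambda>i. \<Sum>m<k. trunc k u (\<sigma> m i))"
  proof
    fix i
    show "(\<Sum>i<k. u i) * of_bool (i < k) = (\<Sum>m<k. trunc k u (\<sigma> m i))"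
      using sum_cyclic_shift[of i k u] by (auto simp: \<sigma>_def trunc_def)
  qed
  then have "\<bar>\<Sum>i<k. u i\<bar> * \<Phi> (\<lambda>i. of_bool (i < k)) = \<Phi> (\<lambda>i. \<Sum>m<k. trunc k u (\<sigma> m i))"
    using norm_scale[OF N \<xi>, of "\<Sum>i<k. u i"] by simp
  also have "\<dots> \<le> (\<Sum>m<k. \<Phi> (\<lambda>i. trunc k u (\<sigma> m i)))"
    using k by (intro norm_sum_le[OF N]) (auto simp: Rn_eq \<sigma>_def trunc_def)
  also have "\<dots> = real k * \<Phi> (trunc k u)" by (simp add: shift)
  also have "\<dots> \<le> real k * \<Phi> u" using trunc by (intro mult_left_mono) auto
  finally show ?thesis .
qed

section \<open>Comparison of a \<open>Q'_norm\<close> with the Euclidean and l1 norms\<close>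

lemma lower_norm_eq: "lower_norm k l x = l (trunc k x)"
  by (simp add: lower_norm_def trunc_def)

lemma is_norm_lower_norm:
  assumes l: "is_norm n l" and k: "k \<le> n"
  shows "is_norm k (lower_norm k l)"
proof -
  have sub: "x \<in> Rn n" if "x \<in> Rn k" for x using that k by (auto simp: Rn_eq)
  have cl: "(\<lambda>i. a * x i) \<in> Rn k" "(\<lambda>i. x i + y i) \<in> Rn k" if "x \<in> Rn k" "y \<in> Rn k" for a x y
    using that by (auto simp: Rn_eq)
  show ?thesis
    unfolding is_norm_def lower_norm_eq using l sub
    by (simp add: trunc_id cl is_norm_def)
qed

text \<open>Both bounds share one scale \<open>A\<close>, the dual norm of the indicator
  \<open>\<xi>\<close>; it later cancels in the quotient of maximum by median.\<close>

lemma Q'_norm_comparison: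
  assumes Q: "Q'_norm n l" and k: "1 \<le> k" "k \<le> n"
  shows "\<exists>A>0. \<forall>x\<in>usphere k. l x \<le> sqrt (real k) / A \<and> (\<Sum>i<k. \<bar>x i\<bar>) \<le> A * l x"
proof -
  have l: "is_norm n l" and D: "is_norm n (dual_norm n l)" using Q by (auto simp: Q'_norm_def Q_norm_def)
  obtain \<Phi> where \<Phi>: "symmetric_norm n \<Phi>" "\<And>x. x \<in> Rn n \<Longrightarrow> dual_norm n l x = sqrt (\<Phi> (\<lambda>i. (x i)\<^sup>2))"
    using Q by (auto simp: Q'_norm_def Q_norm_def)
  define \<xi> :: "nat \<Rightarrow> real" where "\<xi> = (\<lambda>i. of_bool (i < k))"
  have \<xi>: "\<xi> \<in> Rn n" "\<xi> \<noteq> (\<lambda>i. 0)" using k by (auto simp: Rn_eq \<xi>_def fun_eq_iff intro!: exI[of _ 0])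
  have N: "is_norm n \<Phi>" using \<Phi> by (simp add: symmetric_norm_def)
  have pos: "0 < \<Phi> \<xi>" using N \<xi> unfolding is_norm_def by (metis order_le_less)
  define A where "A = sqrt (\<Phi> \<xi>)"
  have A: "0 < A" using pos by (simp add: A_def)
  have "l x \<le> sqrt (real k) / A \<and> (\<Sum>i<k. \<bar>x i\<bar>) \<le> A * l x" if x: "x \<in> usphere k" for x
  proof
    have xk: "x \<in> Rn k" "L2_set x {..<k} = 1" using x by (auto simp: usphere_def)
    have xn: "x \<in> Rn n" using xk k by (auto simp: Rn_eq)
    have sum_eq: "(\<Sum>i<n. f i * x i) = (\<Sum>i<k. f i * x i)" for f
      using k xk by (intro sum.mono_neutral_right) (auto simp: Rn_eq)
    obtain c where c: "c \<in> Rn n" "dual_norm n l c \<le> 1" "l x \<le> (\<Sum>i<n. c i * x i)"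
      using norm_attained_by_dual[OF l _ xn] k by auto
    have u: "(\<lambda>i. (c i)\<^sup>2) \<in> Rn n" using c by (auto simp: Rn_eq)
    have "(\<Sum>i<k. (c i)\<^sup>2) * \<Phi> \<xi> \<le> real k * \<Phi> (\<lambda>i. (c i)\<^sup>2)"
      using symmetric_norm_average[OF \<Phi>(1) u k(2)] by (simp add: \<xi>_def sum_nonneg)
    also have "\<dots> \<le> real k * 1"
      using c(2) \<Phi>(2)[OF c(1)] by (intro mult_left_mono) auto
    finally have "sqrt ((\<Sum>i<k. (c i)\<^sup>2) * \<Phi> \<xi>) \<le> sqrt (real k)" by simp
    then have L: "L2_set c {..<k} \<le> sqrt (real k) / A"
      using A by (simp add: L2_set_def A_def real_sqrt_mult pos_le_divide_eq)
    have "l x \<le> (\<Sum>i<k. c i * x i)" using c(3) by (simp add: sum_eq)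
    also have "\<dots> \<le> (\<Sum>i<k. \<bar>c i\<bar> * \<bar>x i\<bar>)" by (intro sum_mono) (metis abs_ge_self abs_mult)
    also have "\<dots> \<le> L2_set c {..<k} * L2_set x {..<k}" by (rule L2_set_mult_ineq)
    finally show "l x \<le> sqrt (real k) / A" using L xk by simp
    \<comment> \<open>The sign at a zero of \<open>x\<close> is 1 and not 0, so that the square of
      \<open>y\<close> is exactly \<open>\<xi>\<close> for every \<open>x\<close>.\<close>
    define y where "y = (\<lambda>i. (if x i < 0 then - 1 else 1) * \<xi> i)"
    have y: "y \<in> Rn n" using \<xi>(1) by (auto simp: Rn_eq y_def)
    have "(\<lambda>i. (y i)\<^sup>2) = \<xi>" by (auto simp: y_def \<xi>_def)
    then have "dual_norm n l y = A" using \<Phi>(2)[OF y] by (simp add: A_def)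
    then have "(\<Sum>i<k. y i * x i) \<le> A * l x" using pairing_le_dual[OF l y xn] by (simp add: sum_eq)
    moreover have "(\<Sum>i<k. y i * x i) = (\<Sum>i<k. \<bar>x i\<bar>)"
      by (intro sum.cong) (auto simp: y_def \<xi>_def)
    ultimately show "(\<Sum>i<k. \<bar>x i\<bar>) \<le> A * l x" by simp
  qed
  with A show ?thesis by (intro exI[of _ A]) simp
qed

section \<open>The \<open>\<ell>\<^sub>1\<close> norm on the sphere\<close>

text \<open>The integrand is dominated by e/c times an exponential density plus its reflection, each
  of mass 1. At 0 both densities count, hence an inequality.\<close>

lemma nn_integral_two_sided_exponential:
  assumes "0 < c"
  shows "(\<integral>\<^sup>+t. ennreal (exp (1 - c * \<bar>t\<bar>)) \<partial>lborel) \<le> ennreal (2 * exp 1 / c)"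
proof -
  let ?d = "exponential_density c"
  have one: "(\<integral>\<^sup>+t. ennreal (?d t) \<partial>lborel) = 1"
    using prob_space.emeasure_space_1[OF prob_space_exponential_density[OF assms]]
    by (simp add: emeasure_density)
  have two: "(\<integral>\<^sup>+t. ennreal (?d (- t)) \<partial>lborel) = 1"
    using nn_integral_real_affine[of "\<lambda>t. ennreal (?d t)" "- 1" 0] one by simp
  have "(\<integral>\<^sup>+t. ennreal (exp (1 - c * \<bar>t\<bar>)) \<partial>lborel)
      \<le> (\<integral>\<^sup>+t. ennreal (exp 1 / c) * (ennreal (?d t) + ennreal (?d (- t))) \<partial>lborel)"
  proof (rule nn_integral_mono)
    fix t :: real
    have nn: "0 \<le> ?d t" "0 \<le> ?d (- t)" using assms by (auto intro: exponential_density_nonneg)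
    have "exp (1 - c * \<bar>t\<bar>) \<le> exp 1 / c * (?d t + ?d (- t))"
      using assms by (auto simp: exponential_density_def exp_diff exp_minus field_simps abs_if)
    then show "ennreal (exp (1 - c * \<bar>t\<bar>)) \<le> ennreal (exp 1 / c) * (ennreal (?d t) + ennreal (?d (- t)))"
      using nn assms by (simp add: ennreal_plus[symmetric] ennreal_mult[symmetric] del: ennreal_plus)
  qed
  also have "\<dots> = ennreal (exp 1 / c) * 2"
    by (simp add: nn_integral_cmult nn_integral_add one two)
  also have "\<dots> = ennreal (2 * exp 1 / c)"
    using assms by (simp add: ennreal_mult'[symmetric] ennreal_numeral[symmetric] mult.commute
        del: ennreal_numeral)
  finally show ?thesis .
qed

lemma power_mono_ennreal: "a \<le> b \<Longrightarrow> a ^ k \<le> b ^ k" for a b :: ennreal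
  by (induction k) (simp_all add: mult_mono)

text \<open>Exponential Markov bound: the indicator of the ball is at most a product of
  one-dimensional exponentials, whose integral factorises.\<close>

lemma l1_ball_volume_le:
  fixes r :: real
  assumes k: "1 \<le> k" and r: "0 < r"
  shows "emeasure (\<Pi>\<^sub>M i\<in>{..<k}. lborel) {w \<in> space (\<Pi>\<^sub>M i\<in>{..<k}. lborel). (\<Sum>i<k. \<bar>w i\<bar>) \<le> r}
     \<le> ennreal ((2 * exp 1 * r / real k) ^ k)"
proof -
  interpret product_sigma_finite "\<lambda>_::nat. lborel :: real measure" ..
  let ?L = "\<Pi>\<^sub>M i\<in>{..<k}. lborel :: real measure"
  \<comment> \<open>This value minimises the bound exp(c r) (2/c)^k; then c r = k, which gives one
    factor e per coordinate.\<close>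
  define c where "c = real k / r"
  have c: "0 < c" using k r by (simp add: c_def)
  let ?B = "{w \<in> space ?L. (\<Sum>i<k. \<bar>w i\<bar>) \<le> r}"
  have B: "?B \<in> sets ?L" by measurable
  have "emeasure ?L ?B = (\<integral>\<^sup>+w. indicator ?B w \<partial>?L)" using B by simp
  also have "\<dots> \<le> (\<integral>\<^sup>+w. (\<Prod>i<k. ennreal (exp (1 - c * \<bar>w i\<bar>))) \<partial>?L)"
  proof (rule nn_integral_mono)
    fix w assume "w \<in> space ?L"
    have eq: "(\<Prod>i<k. ennreal (exp (1 - c * \<bar>w i\<bar>))) = ennreal (exp (real k - c * (\<Sum>i<k. \<bar>w i\<bar>)))"
      by (simp add: prod_ennreal exp_sum[symmetric] sum_subtractf sum_distrib_left)
    show "indicator ?B w \<le> (\<Prod>i<k. ennreal (exp (1 - c * \<bar>w i\<bar>)))"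
    proof (cases "w \<in> ?B")
      case True
      then have "c * (\<Sum>i<k. \<bar>w i\<bar>) \<le> c * r" using c by (intro mult_left_mono) auto
      then have "1 \<le> exp (real k - c * (\<Sum>i<k. \<bar>w i\<bar>))" using r by (simp add: c_def)
      then show ?thesis unfolding eq by (simp add: indicator_def del: one_le_exp_iff)
    qed simp
  qed
  also have "\<dots> = (\<Prod>i<k. \<integral>\<^sup>+t. ennreal (exp (1 - c * \<bar>t\<bar>)) \<partial>lborel)"
    by (rule product_nn_integral_prod) auto
  also have "\<dots> \<le> (\<Prod>i<k. ennreal (2 * exp 1 / c))"
    by (simp only: prod_constant) (rule power_mono_ennreal[OF nn_integral_two_sided_exponential[OF c]])
  also have "\<dots> = ennreal ((2 * exp 1 * r / real k) ^ k)"
    using r by (subst prod_ennreal) (auto simp: c_def)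
  finally show ?thesis .
qed

text \<open>A cube of side \<open>1 / sqrt k\<close> has diagonal 1 and so fits into the ball;
  half-open sides keep the origin out.\<close>

lemma punctured_ball_volume_ge:
  assumes k: "1 \<le> k"
  shows "ennreal ((1 / sqrt (real k)) ^ k) \<le> emeasure (\<Pi>\<^sub>M i\<in>{..<k}. lborel) (punctured_ball k)"
proof -
  interpret product_sigma_finite "\<lambda>_::nat. lborel :: real measure" ..
  let ?a = "1 / sqrt (real k)"
  have "ennreal (?a ^ k) = (\<Prod>i<k. emeasure lborel {0<..?a})"
    by (simp add: ennreal_power)
  also have "\<dots> = emeasure (\<Pi>\<^sub>M i\<in>{..<k}. lborel) (\<Pi>\<^sub>E i\<in>{..<k}. {0<..?a})"
    by (subst emeasure_PiM) auto
  also have "\<dots> \<le> emeasure (\<Pi>\<^sub>M i\<in>{..<k}. lborel) (punctured_ball k)"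
  proof (intro emeasure_mono pb_sets subsetI)
    fix y assume y: "y \<in> (\<Pi>\<^sub>E i\<in>{..<k}. {0<..?a})"
    have "(\<Sum>i<k. (y i)\<^sup>2) \<le> (\<Sum>i<k. ?a\<^sup>2)"
      using y by (intro sum_mono power_mono) (auto simp: PiE_iff intro: less_imp_le)
    also have "\<dots> = 1" using k by (simp add: power_divide)
    finally have "L2_set y {..<k} \<le> 1" by (simp add: L2_set_def)
    moreover have "y 0 \<noteq> 0" using PiE_mem[OF y, of 0] k by auto
    then have "L2_set y {..<k} \<noteq> 0" using k by (auto simp: L2_set_eq_0_iff)
    then have "0 < L2_set y {..<k}" using L2_set_nonneg[of y "{..<k}"] by linarith
    ultimately show "y \<in> punctured_ball k" using y by (auto simp: punctured_ball_def space_PiM PiE_iff)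
  qed
  finally show ?thesis .
qed

section \<open>From volumes to the sphere measure\<close>

text \<open>The numerator is the volume of the cone over \<open>S\<close> inside the ball, so
  spherical probabilities can be estimated by volumes.\<close>

lemma emeasure_sphere_measure:
  assumes S: "S \<in> sets (restrict_space borel (usphere k))"
  shows "emeasure (sphere_measure k) S = emeasure (\<Pi>\<^sub>M i\<in>{..<k}. lborel)
      {w \<in> punctured_ball k. (\<lambda>i. if i < k then w i / L2_set w {..<k} else 0) \<in> S}
    / emeasure (\<Pi>\<^sub>M i\<in>{..<k}. lborel) (punctured_ball k)"
proof -
  let ?L = "\<Pi>\<^sub>M i\<in>{..<k}. lborel :: real measure"
  let ?R = "restrict_space ?L (punctured_ball k)"
  let ?r = "\<lambda>y i. if i < k then y i / L2_set y {..<k} else 0"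
  let ?A = "{w \<in> punctured_ball k. ?r w \<in> S}"
  have sp: "space ?R = punctured_ball k" by (auto simp: space_restrict_space punctured_ball_def)
  have A': "?A = ?r -` S \<inter> space ?R" unfolding sp by auto
  have AR: "?A \<in> sets ?R" unfolding A' by (rule measurable_sets[OF radial_measurable S])
  have r: "?r \<in> uniform_measure ?R (punctured_ball k) \<rightarrow>\<^sub>M restrict_space borel (usphere k)"
    using radial_measurable by (simp add: measurable_def)
  have "emeasure (sphere_measure k) S = emeasure (uniform_measure ?R (punctured_ball k)) ?A"
    unfolding sphere_measure_def A' by (subst emeasure_distr[OF r S]) simp
  also have "\<dots> = emeasure ?R (punctured_ball k \<inter> ?A) / emeasure ?R (punctured_ball k)"
    using AR sets.top[of ?R] unfolding sp by (intro emeasure_uniform_measure) auto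
  also have "punctured_ball k \<inter> ?A = ?A" by auto
  also have "emeasure ?R ?A = emeasure ?L ?A"
    using pb_sets by (intro emeasure_restrict_space) auto
  also have "emeasure ?R (punctured_ball k) = emeasure ?L (punctured_ball k)"
    using pb_sets by (intro emeasure_restrict_space) auto
  finally show ?thesis .
qed

lemma l1_small_sets:
  "{x \<in> usphere k. (\<Sum>i<k. \<bar>x i\<bar>) < t} \<in> sets (restrict_space borel (usphere k))"
proof -
  have "open {x::nat \<Rightarrow> real. (\<Sum>i<k. \<bar>x i\<bar>) < t}"
    by (intro open_Collect_less continuous_intros) simp
  then have "{x::nat \<Rightarrow> real. (\<Sum>i<k. \<bar>x i\<bar>) < t} \<in> sets borel" by simp
  then have "usphere k \<inter> {x. (\<Sum>i<k. \<bar>x i\<bar>) < t} \<in> sets (restrict_space borel (usphere k))"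
    by (auto simp: sets_restrict_space)
  then show ?thesis by (simp add: Int_def)
qed

text \<open>The two volume bounds have quotient (2e/12)^k = (e/6)^k. The constant 12 exceeds 4e,
  which puts this below 1/2 even at \<open>k = 1\<close>, the worst case.\<close>

lemma l1_concentration:
  assumes k: "1 \<le> k"
  shows "measure (sphere_measure k) {x \<in> usphere k. (\<Sum>i<k. \<bar>x i\<bar>) < sqrt (real k) / 12} < 1 / 2"
proof -
  let ?L = "\<Pi>\<^sub>M i\<in>{..<k}. lborel :: real measure"
  let ?s = "sqrt (real k)"
  let ?S = "{x \<in> usphere k. (\<Sum>i<k. \<bar>x i\<bar>) < ?s / 12}"
  let ?r = "\<lambda>y i. if i < k then y i / L2_set y {..<k} else 0"
  let ?A = "{w \<in> punctured_ball k. ?r w \<in> ?S}"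
  interpret prob_space "sphere_measure k" by (rule prob_space_sphere_measure[OF k])
  have s: "0 < ?s" using k by simp
  \<comment> \<open>Points of the cone have Euclidean length at most 1, so the l1 bound for their
    directions passes to them.\<close>
  have "?A \<subseteq> {w \<in> space ?L. (\<Sum>i<k. \<bar>w i\<bar>) \<le> ?s / 12}"
  proof
    fix w assume w: "w \<in> ?A"
    then have p: "0 < L2_set w {..<k}" "L2_set w {..<k} \<le> 1" by (auto simp: punctured_ball_def)
    have "(\<Sum>i<k. \<bar>w i\<bar>) / L2_set w {..<k} = (\<Sum>i<k. \<bar>?r w i\<bar>)"
      using p by (simp add: sum_divide_distrib)
    also have "\<dots> < ?s / 12" using w by simp
    finally have "(\<Sum>i<k. \<bar>w i\<bar>) \<le> ?s / 12 * L2_set w {..<k}" using p by (simp add: pos_divide_less_eq)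
    also have "\<dots> \<le> ?s / 12" using p s by (intro mult_left_le) auto
    finally show "w \<in> {w \<in> space ?L. (\<Sum>i<k. \<bar>w i\<bar>) \<le> ?s / 12}"
      using w by (auto simp: punctured_ball_def)
  qed
  then have "emeasure ?L ?A \<le> emeasure ?L {w \<in> space ?L. (\<Sum>i<k. \<bar>w i\<bar>) \<le> ?s / 12}"
    by (intro emeasure_mono) auto
  also have "\<dots> \<le> ennreal ((2 * exp 1 * (?s / 12) / real k) ^ k)"
    by (rule l1_ball_volume_le[OF k]) (use s in simp)
  also have "2 * exp 1 * (?s / 12) / real k = exp 1 / 6 * (1 / ?s)"
    using k by (simp add: field_simps)
  also have "ennreal ((exp 1 / 6 * (1 / ?s)) ^ k) = ennreal ((exp 1 / 6) ^ k) * ennreal ((1 / ?s) ^ k)"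
    by (simp only: power_mult_distrib) (simp add: ennreal_mult)
  also have "\<dots> \<le> ennreal ((exp 1 / 6) ^ k) * emeasure ?L (punctured_ball k)"
    by (intro mult_left_mono punctured_ball_volume_ge k) auto
  finally have "emeasure ?L ?A / emeasure ?L (punctured_ball k) \<le> ennreal ((exp 1 / 6) ^ k)"
    using pb_pos[OF k] pb_finite[of k]
    by (intro divide_le_posI_ennreal) (auto simp: mult.commute)
  then have "ennreal (measure (sphere_measure k) ?S) \<le> ennreal ((exp 1 / 6) ^ k)"
    using emeasure_sphere_measure[OF l1_small_sets[of k "?s / 12"]] by (simp add: emeasure_eq_measure)
  then have "measure (sphere_measure k) ?S \<le> (exp 1 / 6) ^ k" by simp
  also have "\<dots> \<le> (exp 1 / 6) ^ 1"
    using k exp_le by (intro power_decreasing) auto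
  also have "\<dots> < 1 / 2" using e_less_272 by simp
  finally show ?thesis .
qed

section \<open>Maximum against median\<close>

lemma mc_Q'_norm_le:
  assumes Q: "Q'_norm n l" and k: "1 \<le> k" "k \<le> n"
  shows "mc k (lower_norm k l) \<le> 12"
proof -
  let ?p = "lower_norm k l"
  let ?s = "sqrt (real k)"
  let ?S = "{x \<in> usphere k. (\<Sum>i<k. \<bar>x i\<bar>) < ?s / 12}"
  have p: "is_norm k ?p" using Q k by (intro is_norm_lower_norm[of n]) (auto simp: Q'_norm_def)
  obtain A where A: "0 < A" "\<And>x. x \<in> usphere k \<Longrightarrow> l x \<le> ?s / A"
    "\<And>x. x \<in> usphere k \<Longrightarrow> (\<Sum>i<k. \<bar>x i\<bar>) \<le> A * l x"
    using Q'_norm_comparison[OF Q k] by blast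
  have pl: "?p x = l x" if "x \<in> usphere k" for x
    using that by (simp add: lower_norm_eq trunc_id usphere_def)
  have max: "sphere_max k ?p \<le> ?s / A"
    using sphere_max_attained[OF p k(1)] A(2) pl by metis
  interpret S: prob_space "sphere_measure k" by (rule prob_space_sphere_measure[OF k(1)])
  have sp: "space (sphere_measure k) = usphere k" by (simp add: sphere_measure_def space_restrict_space)
  have sets: "?S \<in> sets (sphere_measure k)" by (simp add: sphere_measure_def l1_small_sets del: less_divide_eq_numeral1)
  let ?m = "sphere_median k ?p"
  have "is_median (distr (sphere_measure k) borel ?p) ?m"
    unfolding sphere_median_def by (rule theI'[OF median_unique[OF p k(1)]])
  then have "1 / 2 \<le> measure (sphere_measure k) (?p -` {..?m} \<inter> usphere k)"
    by (simp add: is_median_def measure_distr[OF norm_measurable'[OF p]] sp)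
  \<comment> \<open>A smaller median would place an event of mass at least 1/2 inside
    \<open>?S\<close>, whose mass is below 1/2.\<close>
  moreover have "measure (sphere_measure k) (?p -` {..?m} \<inter> usphere k) \<le> measure (sphere_measure k) ?S"
    if m: "?m < ?s / (12 * A)"
  proof (intro S.finite_measure_mono sets subsetI)
    fix x assume x: "x \<in> ?p -` {..?m} \<inter> usphere k"
    then have "A * l x \<le> A * ?m" using A(1) pl[of x] by (intro mult_left_mono) auto
    also have "\<dots> < ?s / 12" using m A(1) by (simp add: field_simps)
    finally show "x \<in> ?S" using x A(3)[of x] by auto
  qed
  ultimately have m: "?s / (12 * A) \<le> ?m"
    using l1_concentration[OF k(1)] by (meson linorder_not_le order_trans)
  have s: "0 < ?s" using k by simp
  then have "0 < ?s / (12 * A)" using A(1) by simp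
  then have "mc k ?p \<le> (?s / A) / (?s / (12 * A))"
    unfolding mc_def using max m s A(1) by (intro frac_le) auto
  also have "\<dots> = 12" using s A(1) by (simp add: field_simps)
  finally show ?thesis .
qed

theorem theorem6p4:
  shows "\<exists>C::real. C > 0 \<and>
    (\<forall>n::nat. n \<ge> 2 \<longrightarrow>
      (\<forall>l' :: (nat \<Rightarrow> real) \<Rightarrow> real. Q'_norm n l' \<longrightarrow> mmc n l' \<le> C * ln (real n)))"
\<comment> \<open>The constant bound 12 is turned into a logarithmic one by ln n >= ln 2.\<close>
proof (intro exI[of _ "12 / ln 2"] conjI allI impI)
  fix n :: nat and l' :: "(nat \<Rightarrow> real) \<Rightarrow> real"
  assume n: "n \<ge> 2" and Q: "Q'_norm n l'"
  have "mmc n l' \<le> 12"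
    unfolding mmc_def using n mc_Q'_norm_le[OF Q] by (intro Max.boundedI) auto
  also have "\<dots> \<le> 12 / ln 2 * ln (real n)"
    using n by (simp add: field_simps)
  finally show "mmc n l' \<le> 12 / ln 2 * ln (real n)" .
qed simp

end
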